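(* For every $n\ge 1$ there is a bijection $\Omega_n:\mathcal{Q}_n\to\mathcal{Q}_n$ such that $\mathrm{des}(\pi)=\mathrm{asc}(\Omega_n(\pi))$ for all $\pi\in\mathcal{Q}_n$.
   Context: Permutations of $[n]=\{1,\dots,n\}$ are written as words $\pi(1)\cdots\pi(n)$. $\mathrm{des}(\pi)$ (resp. $\mathrm{asc}(\pi)$) is the number of indices $i\in[n-1]$ with $\pi(i)>\pi(i+1)$ (resp. $\pi(i)<\pi(i+1)$). $\mathcal{Q}_n$ denotes the set of permutations $\pi$ of $[n]$ such that $\pi(1)<\pi(2)<\cdots<\pi(p)$ where $p=\pi^{-1}(n)$ (i.e. $n$ is the top of the first descent; the identity permutation is included). *)

theory Defs
  imports "HOL-Combinatorics.Permutations"
begin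

text \<open>A permutation of \<open>[n]\<close> is a function \<open>\<pi> :: nat \<Rightarrow> nat\<close> with \<open>\<pi> permutes {1..n}\<close>
  (so it is the identity outside \<open>{1..n}\<close>), read as the word \<open>\<pi> 1 \<dots> \<pi> n\<close>.\<close>

definition des :: "nat \<Rightarrow> (nat \<Rightarrow> nat) \<Rightarrow> nat" where
  "des n \<pi> = card {i \<in> {1..<n}. \<pi> i > \<pi> (i + 1)}"

definition asc :: "nat \<Rightarrow> (nat \<Rightarrow> nat) \<Rightarrow> nat" where
  "asc n \<pi> = card {i \<in> {1..<n}. \<pi> i < \<pi> (i + 1)}"

definition Q :: "nat \<Rightarrow> (nat \<Rightarrow> nat) set" where
  "Q n = {\<pi>. \<pi> permutes {1..n} \<and> strict_mono_on {1..inv \<pi> n} \<pi>}"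

end

theory Submission
  imports Defs "HOL-Library.Multiset"
begin

text \<open>Cut a word at its least letter \<open>m\<close>. A word of \<open>Q n\<close> with at least two letters is
  \<open>m w\<close>, \<open>u m\<close> or \<open>u m v\<close> with \<open>u\<close>, \<open>v\<close> nonempty, where \<open>w\<close> resp. \<open>u\<close> again increases up to
  its maximum, which is \<open>n\<close>, and \<open>v\<close> is arbitrary. Putting
  \<open>\<Omega>(m w) = \<Omega>(w) m\<close>, \<open>\<Omega>(u m) = m \<Omega>(u)\<close> and \<open>\<Omega>(u m v) = \<Omega>(u) m rev(v)\<close> defines an
  involution that exchanges ascents and descents: the pair ending in \<open>m\<close> is a descent and the one
  starting in \<open>m\<close> an ascent, so the first two cases are swapped and the third is balanced.\<close>

section \<open>Adjacent pairs in a word\<close>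

text \<open>The relation is a parameter so that ascents and descents share one append rule, and
  reversing a word amounts to passing to the converse relation.\<close>

primrec adj_count :: "('a \<Rightarrow> 'a \<Rightarrow> bool) \<Rightarrow> 'a list \<Rightarrow> nat" where
  "adj_count R [] = 0"
| "adj_count R (x # xs) = of_bool (xs \<noteq> [] \<and> R x (hd xs)) + adj_count R xs"

lemma adj_count_append:
  "adj_count R (xs @ ys) =
     adj_count R xs + adj_count R ys + of_bool (xs \<noteq> [] \<and> ys \<noteq> [] \<and> R (last xs) (hd ys))"
  by (induction xs) (auto simp: hd_append)

lemma adj_count_rev: "adj_count R (rev xs) = adj_count (\<lambda>x y. R y x) xs"
  by (induction xs) (auto simp: adj_count_append last_rev)

section \<open>The involution on words\<close>

lemma length_takeWhile_less:
  assumes "x \<in> set xs" "\<not> P x"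
  shows "length (takeWhile P xs) < length xs"
proof -
  have "dropWhile P xs \<noteq> []"
    using assms by (auto simp: dropWhile_eq_Nil_conv)
  then show ?thesis
    by (metis append_eq_conv_conj length_append length_greater_0_conv less_add_same_cancel1
        takeWhile_dropWhile_id)
qed

lemma length_tl_dropWhile_less: "xs \<noteq> [] \<Longrightarrow> length (tl (dropWhile P xs)) < length xs"
  using length_dropWhile_le[of P xs] by (cases xs) auto

function omega :: "'a::linorder list \<Rightarrow> 'a list" where
  "omega xs =
    (if xs = [] then [] else
     let m = Min (set xs);
         u = takeWhile (\<lambda>x. x \<noteq> m) xs;
         v = tl (dropWhile (\<lambda>x. x \<noteq> m) xs)
     in if u = [] then omega v @ [m]
        else if v = [] then m # omega u
        else omega u @ m # rev v)"
  by auto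
termination
  \<comment> \<open>\<open>u\<close> is shorter than \<open>xs\<close> because it stops before an
    occurrence of the minimum; \<open>v\<close> because at least one letter is dropped.\<close>
  by (relation "measure length")
    (simp_all add: length_takeWhile_less[OF Min_in] length_tl_dropWhile_less del: length_tl)

declare omega.simps [simp del]

lemma omega_Nil [simp]: "omega [] = []"
  by (simp add: omega.simps)

text \<open>Since \<open>m\<close> is strictly below all other letters, it is the minimum and occurs
  once, so the scan for it cuts the word exactly into \<open>u\<close> and \<open>v\<close>. This
  replaces the looping defining equation as a rewrite rule.\<close>

lemma omega_append_min:
  assumes "\<forall>y\<in>set u \<union> set v. m < y"
  shows "omega (u @ m # v) =
    (if u = [] then omega v @ [m] else if v = [] then m # omega u else omega u @ m # rev v)"
proof -
  have "Min (set (u @ m # v)) = m"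
    using assms by (intro Min_eqI) (auto simp: less_imp_le)
  moreover have "m \<notin> set u"
    using assms by auto
  moreover from this have "takeWhile (\<lambda>x. x \<noteq> m) (u @ m # w) = u"
    and "dropWhile (\<lambda>x. x \<noteq> m) (u @ m # w) = m # w" for w
    by (subst takeWhile_append2 dropWhile_append2; auto)+
  ultimately show ?thesis
    by (subst omega.simps) (simp add: Let_def)
qed

lemma omega_Cons_min: "\<forall>y\<in>set w. m < y \<Longrightarrow> omega (m # w) = omega w @ [m]"
  using omega_append_min[of "[]" w m] by simp

lemma omega_snoc_min: "u \<noteq> [] \<Longrightarrow> \<forall>y\<in>set u. m < y \<Longrightarrow> omega (u @ [m]) = m # omega u"
  using omega_append_min[of u "[]" m] by simp

lemma omega_mid_min:
  "u \<noteq> [] \<Longrightarrow> v \<noteq> [] \<Longrightarrow> \<forall>y\<in>set u \<union> set v. m < y \<Longrightarrow> omega (u @ m # v) = omega u @ m # rev v"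
  using omega_append_min[of u v m] by simp

text \<open>Induction on length along the cut at the least letter, shaped like the recursion of
  \<open>omega\<close>. The case \<open>mid\<close> carries \<open>P u\<close> alone because there
  \<open>omega\<close> recurses on \<open>u\<close> and merely reverses \<open>v\<close>.\<close>

lemma distinct_min_induct [consumes 1, case_names Nil Cons snoc mid]:
  fixes xs :: "'a::linorder list"
  assumes "distinct xs"
    and Nil: "P []"
    and Cons: "\<And>m w. distinct w \<Longrightarrow> \<forall>y\<in>set w. m < y \<Longrightarrow> P w \<Longrightarrow> P (m # w)"
    and snoc: "\<And>m u. u \<noteq> [] \<Longrightarrow> distinct u \<Longrightarrow> \<forall>y\<in>set u. m < y \<Longrightarrow> P u \<Longrightarrow> P (u @ [m])"
    and mid: "\<And>m u v. u \<noteq> [] \<Longrightarrow> v \<noteq> [] \<Longrightarrow> distinct (u @ v) \<Longrightarrow>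
      \<forall>y\<in>set u \<union> set v. m < y \<Longrightarrow> P u \<Longrightarrow> P (u @ m # v)"
  shows "P xs"
  using assms(1)
proof (induction xs rule: length_induct)
  case (1 xs)
  show ?case
  proof (cases "xs = []")
    case False
    define m where "m = Min (set xs)"
    have "m \<in> set xs"
      using False by (simp add: m_def)
    then obtain u v where xs: "xs = u @ m # v"
      by (meson split_list)
    have d: "distinct (u @ v)" "m \<notin> set u \<union> set v"
      using 1 xs by auto
    have "\<forall>y\<in>set xs. m \<le> y"
      by (simp add: m_def)
    then have lt: "\<forall>y\<in>set u \<union> set v. m < y"
      using d xs by (auto simp: order_less_le)
    have "P u" "P v"
      using 1 xs d by auto
    then show ?thesis
      using d lt Cons[of v m] snoc[of u m] mid[of u v m] xs by (cases "u = []"; cases "v = []") auto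
  qed (simp add: Nil)
qed

lemma mset_omega: "distinct xs \<Longrightarrow> mset (omega xs) = mset xs"
  by (induction xs rule: distinct_min_induct)
    (simp_all add: omega_Cons_min omega_snoc_min omega_mid_min)

lemma set_omega: "distinct xs \<Longrightarrow> set (omega xs) = set xs"
  by (metis mset_omega mset_eq_setD)

lemma distinct_omega: "distinct xs \<Longrightarrow> distinct (omega xs)"
  by (metis mset_omega mset_eq_imp_distinct_iff)

lemma omega_eq_Nil_iff: "distinct xs \<Longrightarrow> omega xs = [] \<longleftrightarrow> xs = []"
  by (metis set_omega set_empty)

text \<open>\<open>omega\<close> preserves the letters, so \<open>m\<close> stays least and the
  second pass cuts at it again: the first two shapes turn into each other, and the third is kept
  while \<open>v\<close> is reversed twice. A single letter belongs to \<open>Cons\<close> and is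
  its own image, hence the split on \<open>w = []\<close>.\<close>

lemma omega_omega: "distinct xs \<Longrightarrow> omega (omega xs) = xs"
proof (induction xs rule: distinct_min_induct)
  case (Cons m w)
  then show ?case
    by (cases "w = []") (simp_all add: omega_Cons_min omega_snoc_min set_omega omega_eq_Nil_iff)
qed (simp_all add: omega_Cons_min omega_snoc_min omega_mid_min set_omega omega_eq_Nil_iff)

lemma less_hd_last:
  fixes m :: "'a::linorder"
  assumes "xs \<noteq> []" "\<forall>y\<in>set xs. m < y"
  shows "m < hd xs" "m < last xs" "\<not> hd xs < m" "\<not> last xs < m"
  using assms by (auto dest: less_asym)

lemma less_hd_last_omega:
  assumes "distinct xs" "xs \<noteq> []" "\<forall>y\<in>set xs. m < y"
  shows "m < hd (omega xs)" "m < last (omega xs)" "\<not> hd (omega xs) < m" "\<not> last (omega xs) < m"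
  using assms less_hd_last[of "omega xs" m] by (simp_all add: set_omega omega_eq_Nil_iff)

text \<open>Only the pairs containing \<open>m\<close> need care. In the first two cases such a pair
  is neither a descent of the word nor an ascent of its image, or it is both. In the third,
  \<open>m\<close> adds one descent before it to the word and one ascent after it to the image, and
  \<open>rev v\<close> has as many ascents as \<open>v\<close> has descents.\<close>

lemma adj_count_omega:
  "distinct xs \<Longrightarrow> adj_count (\<lambda>x y. x < y) (omega xs) = adj_count (\<lambda>x y. x > y) xs"
proof (induction xs rule: distinct_min_induct)
  case (Cons m w)
  then show ?case
    by (cases "w = []")
      (simp_all add: omega_Cons_min adj_count_append omega_eq_Nil_iff less_hd_last less_hd_last_omega)
next
  case (snoc m u)
  then show ?case
    by (simp add: omega_snoc_min adj_count_append omega_eq_Nil_iff less_hd_last less_hd_last_omega)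
next
  case (mid m u v)
  then show ?case
    by (simp add: omega_mid_min adj_count_append adj_count_rev omega_eq_Nil_iff hd_rev
        less_hd_last less_hd_last_omega)
qed simp

section \<open>Words increasing up to their maximum\<close>

text \<open>The defining condition of \<open>Q\<close> for words. \<open>M\<close> is a parameter
  because it stays the same for all subwords met in the recursion. The prefix stops before
  \<open>M\<close>: when \<open>M\<close> is the maximum of a distinct word, the final rise to it is
  automatic.\<close>

definition incr_upto :: "'a::linorder \<Rightarrow> 'a list \<Rightarrow> bool" where
  "incr_upto M xs \<longleftrightarrow> M \<in> set xs \<and> sorted_wrt (<) (takeWhile (\<lambda>x. x \<noteq> M) xs)"

lemma incr_upto_Cons:
  assumes "w \<noteq> []" "\<forall>y\<in>set w. m < y" "\<forall>y\<in>set w. y \<le> M"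
  shows "incr_upto M (m # w) \<longleftrightarrow> incr_upto M w"
proof -
  have "m \<noteq> M"
    using assms by (cases w) auto
  then show ?thesis
    using assms by (auto simp: incr_upto_def dest: set_takeWhileD)
qed

text \<open>If \<open>M\<close> lies in \<open>u\<close>, the prefix before \<open>M\<close> ends
  before \<open>m\<close>. Otherwise both sides fail: the prefix on the left would contain all of
  \<open>u\<close> and then the smaller letter \<open>m\<close>.\<close>

lemma incr_upto_append_min:
  assumes "u \<noteq> []" "\<forall>y\<in>set u. m < y" "\<forall>y\<in>set u. y \<le> M"
  shows "incr_upto M (u @ m # v) \<longleftrightarrow> incr_upto M u"
proof (cases "M \<in> set u")
  case True
  then show ?thesis
    by (auto simp: incr_upto_def takeWhile_append1)
next
  case False
  moreover have "m \<noteq> M"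
    using assms by (cases u) auto
  ultimately have "takeWhile (\<lambda>x. x \<noteq> M) (u @ m # v) = u @ m # takeWhile (\<lambda>x. x \<noteq> M) v"
    by (subst takeWhile_append2) auto
  moreover have "hd u \<in> set u" "\<not> hd u < m"
    using assms by (auto simp: not_less less_imp_le)
  ultimately show ?thesis
    using False by (auto simp: incr_upto_def sorted_wrt_append)
qed

lemma incr_upto_omega:
  assumes "distinct xs" "incr_upto M xs" "\<forall>y\<in>set xs. y \<le> M"
  shows "incr_upto M (omega xs)"
  using assms
proof (induction xs rule: distinct_min_induct)
  case (Cons m w)
  then show ?case
    by (cases "w = []")
      (auto simp: omega_Cons_min incr_upto_Cons incr_upto_append_min set_omega omega_eq_Nil_iff)
next
  case (snoc m u)
  then show ?case
    by (auto simp: omega_snoc_min incr_upto_Cons incr_upto_append_min set_omega omega_eq_Nil_iff)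
next
  case (mid m u v)
  then show ?case
    by (auto simp: omega_mid_min incr_upto_append_min set_omega omega_eq_Nil_iff)
qed simp

section \<open>Permutations as words\<close>

definition word :: "nat \<Rightarrow> (nat \<Rightarrow> nat) \<Rightarrow> nat list" where
  "word n \<pi> = map \<pi> [1..<Suc n]"

lemma length_word [simp]: "length (word n \<pi>) = n"
  by (simp add: word_def)

lemma nth_word: "i < n \<Longrightarrow> word n \<pi> ! i = \<pi> (Suc i)"
  by (simp add: word_def del: upt_Suc)

lemma adj_count_word: "adj_count R (word n \<pi>) = card {i \<in> {1..<n}. R (\<pi> i) (\<pi> (i + 1))}"
proof (induction n)
  case (Suc n)
  show ?case
  \<comment> \<open>Appending the letter at position \<open>n + 1\<close> creates the pair at
    position \<open>n\<close>, which exists only for positive \<open>n\<close>.\<close>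
  proof (cases "n = 0")
    case False
    have "word (Suc n) \<pi> = word n \<pi> @ [\<pi> (Suc n)]"
      by (simp add: word_def)
    moreover have "word n \<pi> \<noteq> []" "last (word n \<pi>) = \<pi> n"
      using False by (simp_all add: word_def)
    ultimately have "adj_count R (word (Suc n) \<pi>)
        = adj_count R (word n \<pi>) + of_bool (R (\<pi> n) (\<pi> (Suc n)))"
      by (simp add: adj_count_append)
    moreover have "{i \<in> {1..<Suc n}. R (\<pi> i) (\<pi> (i + 1))} =
        (if R (\<pi> n) (\<pi> (Suc n)) then insert n else id) {i \<in> {1..<n}. R (\<pi> i) (\<pi> (i + 1))}"
      using False by (auto simp: less_Suc_eq)
    ultimately show ?thesis
      using Suc by simp
  qed (simp add: word_def)
qed (simp add: word_def)

lemma des_eq_adj_count: "des n \<pi> = adj_count (\<lambda>x y. x > y) (word n \<pi>)"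
  by (simp add: des_def adj_count_word)

lemma asc_eq_adj_count: "asc n \<pi> = adj_count (\<lambda>x y. x < y) (word n \<pi>)"
  by (simp add: asc_def adj_count_word)

lemma bij_betw_word:
  "bij_betw (word n) {\<pi>. \<pi> permutes {1..n}} {xs. distinct xs \<and> set xs = {1..n}}"
proof (rule bij_betwI')
  fix \<pi> \<sigma> assume "\<pi> \<in> {\<pi>. \<pi> permutes {1..n}}" "\<sigma> \<in> {\<pi>. \<pi> permutes {1..n}}"
  moreover have "\<pi> = \<sigma>" if "\<pi> permutes {1..n}" "\<sigma> permutes {1..n}" "word n \<pi> = word n \<sigma>"
  proof
    fix i
    show "\<pi> i = \<sigma> i"
    proof (cases "i \<in> {1..n}")
      case True
      then obtain j where "i = Suc j" "j < n"
        by (cases i) auto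
      then show ?thesis
        using nth_word[of j n \<pi>] nth_word[of j n \<sigma>] that by simp
    qed (use that in \<open>simp add: permutes_not_in\<close>)
  qed
  ultimately show "word n \<pi> = word n \<sigma> \<longleftrightarrow> \<pi> = \<sigma>"
    by auto
next
  fix \<pi> assume "\<pi> \<in> {\<pi>. \<pi> permutes {1..n}}"
  then have "\<pi> permutes {1..n}"
    by simp
  moreover have "set [1..<Suc n] = {1..n}"
    by (auto simp del: upt_Suc)
  ultimately show "word n \<pi> \<in> {xs. distinct xs \<and> set xs = {1..n}}"
    by (auto simp: word_def distinct_map permutes_inj_on permutes_image simp del: upt_Suc set_upt)
next
  fix xs assume "xs \<in> {xs. distinct xs \<and> set xs = {1..n}}"
  then have xs: "distinct xs" "set xs = {1..n}"
    by auto
  then have len: "length xs = n"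
    by (metis card_atLeastAtMost diff_Suc_1 distinct_card)
  \<comment> \<open>The shift turns positions from 1 into list indices from 0; outside
    \<open>{1..n}\<close> the identity is forced by \<open>permutes\<close>.\<close>
  define \<pi> where "\<pi> = (\<lambda>i. if i \<in> {1..n} then xs ! (i - 1) else i)"
  have "bij_betw (\<lambda>i. i - 1) {1..n} {..<n}"
    by (rule bij_betwI[of _ _ _ Suc]) auto
  from bij_betw_trans[OF this bij_betw_nth[of xs "{..<n}" "{1..n}"]]
  have "bij_betw (\<lambda>i. xs ! (i - 1)) {1..n} {1..n}"
    using xs len by (simp add: comp_def)
  then have "bij_betw \<pi> {1..n} {1..n}"
    by (rule bij_betw_cong[THEN iffD1, rotated]) (simp add: \<pi>_def)
  then have "\<pi> permutes {1..n}"
    by (rule bij_imp_permutes) (auto simp: \<pi>_def)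
  moreover have "word n \<pi> = xs"
    using len by (intro nth_equalityI) (auto simp: nth_word \<pi>_def)
  ultimately show "\<exists>\<pi>\<in>{\<pi>. \<pi> permutes {1..n}}. xs = word n \<pi>"
    by blast
qed

lemma strict_mono_on_iff_incr_upto:
  assumes "n \<ge> 1" and \<pi>: "\<pi> permutes {1..n}"
  shows "strict_mono_on {1..inv \<pi> n} \<pi> \<longleftrightarrow> incr_upto n (word n \<pi>)"
proof -
  define p where "p = inv \<pi> n"
  have p: "\<pi> p = n" "p \<in> {1..n}"
    using assms permutes_inverses(1)[OF \<pi>] permutes_in_image[OF permutes_inv[OF \<pi>]]
    by (auto simp: p_def)
  have neq: "\<pi> i \<noteq> n" if "i \<noteq> p" for i
    using that p permutes_inj[OF \<pi>] by (auto dest: injD)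
  have lt: "\<pi> i < n" if "i \<in> {1..<p}" for i
    using that p neq[of i] permutes_in_image[OF \<pi>, of i] by auto
  have neq': "x \<noteq> n" if "x \<in> set (map \<pi> [1..<p])" for x
  proof -
    obtain i where "x = \<pi> i" "i \<in> {1..<p}"
      using \<open>x \<in> _\<close> by auto
    then show ?thesis
      using lt[of i] by simp
  qed
  have "[1..<Suc n] = [1..<p] @ [p..<Suc n]"
    using p upt_add_eq_append[of 1 p "Suc n - p"] by (simp del: upt_Suc)
  also have "[p..<Suc n] = p # [Suc p..<Suc n]"
    using p by (intro upt_conv_Cons) simp
  finally have w: "word n \<pi> = map \<pi> [1..<p] @ n # map \<pi> [Suc p..<Suc n]"
    using p by (simp add: word_def del: upt_Suc)
  \<comment> \<open>By injectivity \<open>n\<close> occurs only at position \<open>p\<close>, so the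
    scan stops exactly there.\<close>
  have "takeWhile (\<lambda>x. x \<noteq> n) (word n \<pi>) = map \<pi> [1..<p]"
    unfolding w using neq' by (subst takeWhile_append2) simp_all
  then have "incr_upto n (word n \<pi>) \<longleftrightarrow> sorted_wrt (<) (map \<pi> [1..<p])"
    using w by (simp add: incr_upto_def)
  \<comment> \<open>The list has length \<open>p - 1\<close>, and index \<open>i\<close> stands for
    position \<open>Suc i\<close>.\<close>
  also have "\<dots> \<longleftrightarrow> (\<forall>i j. i < j \<longrightarrow> j < p - 1 \<longrightarrow> \<pi> (Suc i) < \<pi> (Suc j))"
    by (auto simp: sorted_wrt_iff_nth_less)
  also have "\<dots> \<longleftrightarrow> strict_mono_on {1..<p} \<pi>" (is "?L \<longleftrightarrow> ?R")
  proof
    assume ?L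
    show ?R
    proof (rule strict_mono_onI)
      fix r s assume "r \<in> {1..<p}" "s \<in> {1..<p}" "r < s"
      then show "\<pi> r < \<pi> s"
        using \<open>?L\<close>[rule_format, of "r - 1" "s - 1"] by auto
    qed
  qed (auto intro!: strict_mono_onD[of "{1..<p}" \<pi>])
  \<comment> \<open>The endpoint \<open>p\<close> can be added because its value \<open>n\<close>
    exceeds all earlier ones.\<close>
  also have "\<dots> \<longleftrightarrow> strict_mono_on {1..p} \<pi>"
  proof
    assume *: "strict_mono_on {1..<p} \<pi>"
    show "strict_mono_on {1..p} \<pi>"
    proof (rule strict_mono_onI)
      fix r s assume "r \<in> {1..p}" "s \<in> {1..p}" "r < s"
      then show "\<pi> r < \<pi> s"
        using lt[of r] p strict_mono_onD[OF *, of r s] by (cases "s = p") auto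
    qed
  qed (auto simp: strict_mono_on_def)
  finally show ?thesis
    by (simp add: p_def)
qed

lemma bij_betw_word_Q:
  assumes "n \<ge> 1"
  shows "bij_betw (word n) (Q n) {xs. distinct xs \<and> set xs = {1..n} \<and> incr_upto n xs}"
proof -
  have "Q n = {\<pi>. \<pi> permutes {1..n} \<and> incr_upto n (word n \<pi>)}"
    using assms strict_mono_on_iff_incr_upto by (auto simp: Q_def)
  moreover have "word n ` {\<pi>. \<pi> permutes {1..n}} = {xs. distinct xs \<and> set xs = {1..n}}"
    using bij_betw_word by (rule bij_betw_imp_surj_on)
  ultimately have "word n ` Q n = {xs. distinct xs \<and> set xs = {1..n} \<and> incr_upto n xs}"
    unfolding set_eq_iff by (smt (verit, best) image_iff mem_Collect_eq)
  moreover have "Q n \<subseteq> {\<pi>. \<pi> permutes {1..n}}"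
    by (auto simp: Q_def)
  ultimately show ?thesis
    by (intro bij_betw_subset[OF bij_betw_word])
qed

theorem theorem2p11:
  fixes n :: nat
  assumes "n \<ge> 1"
  shows "\<exists>\<Omega>. bij_betw \<Omega> (Q n) (Q n) \<and> (\<forall>\<pi>\<in>Q n. des n \<pi> = asc n (\<Omega> \<pi>))"
proof -
  define W where "W = {xs. distinct xs \<and> set xs = {1..n} \<and> incr_upto n xs}"
  \<comment> \<open>The word involution is transported to permutations along the bijection
    \<open>word n\<close>.\<close>
  define \<Omega> where "\<Omega> = the_inv_into (Q n) (word n) \<circ> (omega \<circ> word n)"
  have word: "bij_betw (word n) (Q n) W"
    unfolding W_def using assms by (rule bij_betw_word_Q)
  have omega: "omega xs \<in> W" "omega (omega xs) = xs" if "xs \<in> W" for xs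
    using that by (simp_all add: W_def distinct_omega set_omega incr_upto_omega omega_omega)
  then have "bij_betw omega W W"
    \<comment> \<open>As an involution preserving \<open>W\<close>, \<open>omega\<close> serves as
      its own inverse.\<close>
    by (intro bij_betwI[of _ _ _ omega]) auto
  then have "bij_betw \<Omega> (Q n) (Q n)"
    unfolding \<Omega>_def using word by (blast intro: bij_betw_trans bij_betw_the_inv_into)
  moreover have "des n \<pi> = asc n (\<Omega> \<pi>)" if "\<pi> \<in> Q n" for \<pi>
  proof -
    have W: "word n \<pi> \<in> W"
      using word that by (rule bij_betw_apply)
    then have "word n (\<Omega> \<pi>) = omega (word n \<pi>)"
      unfolding \<Omega>_def using f_the_inv_into_f_bij_betw[OF word] omega(1) by simp
    with W show ?thesis
      by (simp add: des_eq_adj_count asc_eq_adj_count adj_count_omega W_def)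
  qed
  ultimately show ?thesis
    by blast
qed

end
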